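(* $R_{\text{gen}}(n) = \Omega(n^{1/5})$ as $n \to \infty$.
   Context: A planar point set is in general position if no three of its points are collinear and no four of its points lie on a common circle. An angle determined by a finite set $\mathcal Q\subset\mathbb{R}^2$ is given by a center $q\in\mathcal Q$ and an unordered pair $\{p,r\}$ of distinct endpoints in $\mathcal Q\setminus\{q\}$, with measure $\angle pqr$; angles of measure $0$ or $\pi$ are ignored. $\mathcal Q$ determines no repeated angle if no two different such angles have equal measure in $(0,\pi)$. For a finite set $\mathcal{P}\subset\mathbb{R}^2$, $R(\mathcal P)$ is the maximum size of a subset $\mathcal Q\subseteq\mathcal P$ that determines no repeated angle. $R_{\text{gen}}(n)$ is the minimum of $R(\mathcal P)$ over all sets $\mathcal P\subset\mathbb{R}^2$ of $n$ points in general position. $f=\Omega(g)$ means there is a constant $C>0$ with $g(n)\le C f(n)$ for all sufficiently large $n$. *)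

theory Defs
  imports "HOL-Analysis.Analysis" "HOL-Library.Landau_Symbols"
begin

definition general_position :: "(real ^ 2) set \<Rightarrow> bool" where
  "general_position P \<longleftrightarrow>
     (\<forall>T\<subseteq>P. card T = 3 \<longrightarrow> \<not> collinear T) \<and>
     (\<forall>T\<subseteq>P. card T = 4 \<longrightarrow> \<not> (\<exists>c r. T \<subseteq> sphere c r))"

text \<open>
  The unoriented angle at the vertex \<open>q\<close>, in \<open>[0, pi]\<close>. It is meaningful only for
  \<open>p \<noteq> q\<close> and \<open>r \<noteq> q\<close>, and is used only then.
\<close>
definition angle_measure :: "real ^ 2 \<Rightarrow> real ^ 2 \<Rightarrow> real ^ 2 \<Rightarrow> real" where
  "angle_measure p q r = arccos (((p - q) \<bullet> (r - q)) / (norm (p - q) * norm (r - q)))"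

text \<open>
  \<open>is_angle Q p q r\<close>: \<open>(q, {p, r})\<close> is an angle determined by \<open>Q\<close>, with the degenerate
  measures \<open>0\<close> and \<open>pi\<close> left out. It is symmetric in \<open>p\<close> and \<open>r\<close>.
\<close>
definition is_angle :: "(real ^ 2) set \<Rightarrow> real ^ 2 \<Rightarrow> real ^ 2 \<Rightarrow> real ^ 2 \<Rightarrow> bool" where
  "is_angle Q p q r \<longleftrightarrow>
     q \<in> Q \<and> p \<in> Q - {q} \<and> r \<in> Q - {q} \<and> p \<noteq> r \<and> angle_measure p q r \<in> {0<..<pi}"

definition no_repeated_angle :: "(real ^ 2) set \<Rightarrow> bool" where
  "no_repeated_angle Q \<longleftrightarrow>
     (\<forall>p q r p' q' r'. is_angle Q p q r \<longrightarrow> is_angle Q p' q' r' \<longrightarrow>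
        angle_measure p q r = angle_measure p' q' r' \<longrightarrow> q = q' \<and> {p, r} = {p', r'})"

definition R :: "(real ^ 2) set \<Rightarrow> nat" where
  "R P = Max {card Q | Q. Q \<subseteq> P \<and> no_repeated_angle Q}"

text \<open>
  The infimum of a nonempty set of natural numbers is its minimum; the set below is nonempty
  since there are \<open>n\<close> points in general position for every \<open>n\<close>.
\<close>
definition R_gen :: "nat \<Rightarrow> nat" where
  "R_gen n = Inf {R P | P. finite P \<and> card P = n \<and> general_position P}"

end

theory Submission
  imports Defs
begin

text \<open>
  Choose \<open>k\<close> points of \<open>P\<close> independently and uniformly, where \<open>14 k\<^sup>5 \<le> n\<close>. A repeated angle
  is a bad \<open>6\<close>-tuple of indices. In each bad tuple there is an index whose point is confined,
  once the other points are fixed, to two lines (an endpoint of only one of the two angles), two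
  circles (the vertex of only one of them), or one circle (two base angles of an isosceles
  triangle). General position leaves at most \<open>6\<close> choices for it, so a tuple is bad with
  probability \<open>O(1/n)\<close> and the expected number of bad tuples is \<open>O(k\<^sup>6/n)\<close>, at most \<open>k/2\<close> with the
  constants below. Deleting one index of every bad tuple leaves \<open>k/2\<close> points. Since the infimum in
  \<open>R_gen\<close> would be \<open>0\<close> over the empty set, one also needs \<open>n\<close> points in general position: take them
  on the parabola \<open>y = x\<^sup>2\<close> with \<open>x > 0\<close>.
\<close>

section \<open>Inner product, determinant and angle in the plane\<close>

text \<open>The determinant of two vectors: the product of their lengths times the sine of the
  oriented angle between them.\<close>

definition cross2 :: "real ^ 2 \<Rightarrow> real ^ 2 \<Rightarrow> real" where
  "cross2 x y = x $ 1 * y $ 2 - x $ 2 * y $ 1"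

lemma inner_2: "(x :: real ^ 2) \<bullet> y = x $ 1 * y $ 1 + x $ 2 * y $ 2"
  by (simp add: inner_vec_def sum_2)

text \<open>Lagrange's identity, that is \<open>cos^2 + sin^2 = 1\<close> scaled by the squared
  lengths.\<close>

lemma inner_cross2_squares: "(a \<bullet> b)\<^sup>2 + (cross2 a b)\<^sup>2 = (norm a * norm b)\<^sup>2"
  unfolding power_mult_distrib power2_norm_eq_inner inner_2 cross2_def
  by (simp add: power2_eq_square algebra_simps)

text \<open>A vanishing determinant is the equality case of Cauchy-Schwarz.\<close>

lemma collinear_2D:
  assumes "cross2 (y - x) (z - x) = 0"
  shows "collinear {x, y, z}"
proof (cases "y = x")
  case True
  then show ?thesis by simp
next
  case False
  have "((y - x) \<bullet> (z - x))\<^sup>2 = (norm (y - x) * norm (z - x))\<^sup>2"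
    using inner_cross2_squares[of "y - x" "z - x"] assms by simp
  then have "\<bar>(y - x) \<bullet> (z - x)\<bar> = \<bar>norm (y - x) * norm (z - x)\<bar>"
    by (simp only: power2_eq_iff abs_eq_iff)
  then have "collinear {0, y - x, z - x}"
    by (simp add: norm_cauchy_schwarz_equal abs_mult)
  then show ?thesis
    by (subst insert_commute, subst collinear_3) auto
qed

lemma angle_measure_commute: "angle_measure p q r = angle_measure r q p"
  by (simp add: angle_measure_def inner_commute mult.commute)

text \<open>Cauchy-Schwarz puts both quotients in \<open>[-1, 1]\<close>, where
  \<open>arccos\<close> is injective. With a zero vector the quotient is 0, as division by 0 gives
  0.\<close>

lemma angle_measure_eq_iff_cos:
  "angle_measure p q r = angle_measure p' q' r' \<longleftrightarrow>
   (p - q) \<bullet> (r - q) / (norm (p - q) * norm (r - q)) =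
   (p' - q') \<bullet> (r' - q') / (norm (p' - q') * norm (r' - q'))"
proof -
  have "\<bar>(u \<bullet> v) / (norm u * norm v)\<bar> \<le> 1" for u v :: "real ^ 2"
    using Cauchy_Schwarz_ineq2[of u v]
    by (cases "u = 0 \<or> v = 0") (auto simp: abs_mult divide_le_eq)
  then show ?thesis
    unfolding angle_measure_def by (intro arccos_eq_iff) auto
qed

text \<open>
  For fixed \<open>\<theta>\<close> both equations are polynomial in the points, and without square roots: linear in an
  endpoint, and the equation of a circle in the vertex.
\<close>
lemma sin_inner_eq_cos_cross2:
  assumes "angle_measure p q r = \<theta>"
  shows "sin \<theta> * ((p - q) \<bullet> (r - q)) = cos \<theta> * cross2 (p - q) (r - q) \<or>
         sin \<theta> * ((p - q) \<bullet> (r - q)) = - (cos \<theta> * cross2 (p - q) (r - q))"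
proof (cases "p = q \<or> r = q")
  case True
  then show ?thesis by (auto simp: cross2_def)
next
  case False
  define a b where "a = p - q" and "b = r - q"
  define N where "N = norm a * norm b"
  have N: "N > 0" using False by (simp add: N_def a_def b_def)
  have le: "\<bar>(a \<bullet> b) / N\<bar> \<le> 1"
    using Cauchy_Schwarz_ineq2[of a b] N by (simp add: N_def)
  then have c: "cos \<theta> = (a \<bullet> b) / N"
    using assms cos_arccos_abs unfolding angle_measure_def a_def b_def N_def by metis
  \<comment> \<open>The unoriented angle fixes the determinant only up to sign, hence the two
    alternatives.\<close>
  have "N\<^sup>2 * (sin \<theta>)\<^sup>2 = (cross2 a b)\<^sup>2"
    using inner_cross2_squares[of a b] N unfolding sin_squared_eq c N_def[symmetric]
    by (simp add: right_diff_distrib power_divide)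
  then have "(sin \<theta> * (a \<bullet> b))\<^sup>2 = (cos \<theta> * cross2 a b)\<^sup>2"
    using N by (simp add: c field_simps)
  then show ?thesis
    unfolding power2_eq_iff a_def b_def .
qed

section \<open>Lines, circles and isosceles triangles in general position\<close>

text \<open>General position speaks of subsets of size 3 and 4 and does not make \<open>P\<close>
  finite, so an infinite \<open>S\<close>, whose \<open>card\<close> is 0, must yield such a subset
  too.\<close>

lemma obtain_subset_of_large:
  assumes "\<not> (finite S \<and> card S \<le> m)"
  obtains T where "T \<subseteq> S" "card T = Suc m"
proof (cases "finite S")
  case True
  then show ?thesis
    using assms that obtain_subset_with_card_n[of "Suc m" S] by auto
next
  case False
  then show ?thesis
    using infinite_arbitrarily_large[of S "Suc m"] that by blast
qed

lemma general_position_card_line: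
  assumes "general_position P" "S \<subseteq> P" "w \<noteq> 0" "\<And>x. x \<in> S \<Longrightarrow> (x - q) \<bullet> w = 0"
  shows "finite S \<and> card S \<le> 2"
proof (rule ccontr)
  assume "\<not> ?thesis"
  then obtain T where T: "T \<subseteq> S" "card T = 3"
    by (rule obtain_subset_of_large) auto
  then obtain x y z where xyz: "T = {x, y, z}"
    by (auto simp: card_3_iff)
  have *: "(y - x) \<bullet> w = 0" "(z - x) \<bullet> w = 0"
    using assms(4)[of x] assms(4)[of y] assms(4)[of z] T xyz
    by (auto simp: inner_diff_left)
  \<comment> \<open>Both differences are orthogonal to \<open>w\<close>; eliminating one coordinate
    of \<open>w\<close> leaves the other times the determinant.\<close>
  have "w $ 1 * cross2 (y - x) (z - x) = 0" "w $ 2 * cross2 (y - x) (z - x) = 0"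
    using * unfolding inner_2 cross2_def by algebra+
  moreover have "w $ 1 \<noteq> 0 \<or> w $ 2 \<noteq> 0"
    using \<open>w \<noteq> 0\<close> by (simp add: vec_eq_iff forall_2)
  ultimately have "collinear T"
    using collinear_2D xyz by fastforce
  then show False
    using assms(1,2) T unfolding general_position_def by blast
qed

lemma general_position_card_sphere:
  assumes "general_position P" "S \<subseteq> P" "S \<subseteq> sphere c r"
  shows "finite S \<and> card S \<le> 3"
proof (rule ccontr)
  assume "\<not> ?thesis"
  then obtain T where T: "T \<subseteq> S" "card T = 4"
    by (rule obtain_subset_of_large) auto
  then show False
    using assms unfolding general_position_def by (meson subset_trans)
qed

text \<open>For each orientation the angle equation is linear in \<open>x\<close>: two lines through
  \<open>q\<close>, each with at most two points of \<open>P\<close>.\<close>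

lemma general_position_card_endpoint:
  assumes "general_position P" "r \<noteq> q" "\<theta> \<in> {0<..<pi}"
  shows "card {x \<in> P. angle_measure x q r = \<theta>} \<le> 4"
proof -
  define u where "u = r - q"
  \<comment> \<open>A normal of the line for the sign \<open>s\<close>:
    \<open>(x - q) \<bullet> w s\<close> is \<open>sin \<theta> * ((x - q) \<bullet> u) - s * cos
    \<theta> * cross2 (x - q) u\<close>.\<close>
  define w where "w s = (vector [sin \<theta> * u $ 1 - s * cos \<theta> * u $ 2,
                                  sin \<theta> * u $ 2 + s * cos \<theta> * u $ 1] :: real ^ 2)" for s
  define L where "L s = {x \<in> P. (x - q) \<bullet> w s = 0}" for s
  have "u \<noteq> 0" using assms by (simp add: u_def)
  have w: "w s \<noteq> 0" if "s = 1 \<or> s = -1" for s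
  proof
    assume "w s = 0"
    then have "w s $ 1 = 0" "w s $ 2 = 0" by auto
    then have "sin \<theta> * u $ 1 - s * cos \<theta> * u $ 2 = 0" "sin \<theta> * u $ 2 + s * cos \<theta> * u $ 1 = 0"
      by (auto simp: w_def)
    \<comment> \<open>The linear map taking \<open>u\<close> to \<open>w s\<close> has determinant
      1, so \<open>u\<close> would vanish.\<close>
    then have "((sin \<theta>)\<^sup>2 + (cos \<theta>)\<^sup>2) * u $ 1 = 0" "((sin \<theta>)\<^sup>2 + (cos \<theta>)\<^sup>2) * u $ 2 = 0"
      using that by algebra+
    then show False
      using \<open>u \<noteq> 0\<close> by (simp add: vec_eq_iff forall_2)
  qed
  have L: "finite (L s) \<and> card (L s) \<le> 2" if "s = 1 \<or> s = -1" for s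
    by (rule general_position_card_line[OF assms(1) _ w[OF that], where q = q]) (auto simp: L_def)
  have "{x \<in> P. angle_measure x q r = \<theta>} \<subseteq> L 1 \<union> L (-1)"
  proof
    fix x assume "x \<in> {x \<in> P. angle_measure x q r = \<theta>}"
    then have "x \<in> P" "angle_measure x q r = \<theta>" by auto
    then show "x \<in> L 1 \<union> L (-1)"
      using sin_inner_eq_cos_cross2[of x q r \<theta>]
      by (auto simp: L_def inner_2 w_def cross2_def u_def algebra_simps)
  qed
  then have "card {x \<in> P. angle_measure x q r = \<theta>} \<le> card (L 1 \<union> L (-1))"
    using L[of 1] L[of "-1"] by (intro card_mono) auto
  also have "\<dots> \<le> card (L 1) + card (L (-1))"
    by (rule card_Un_le)
  also have "\<dots> \<le> 4"
    using L[of 1] L[of "-1"] by simp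
  finally show ?thesis .
qed

text \<open>By the inscribed angle theorem the vertex lies on one of two circles, one for each
  orientation, and each carries at most three points of \<open>P\<close>.\<close>

lemma general_position_card_center:
  assumes "general_position P" "\<theta> \<in> {0<..<pi}"
  shows "card {x \<in> P. angle_measure p x r = \<theta>} \<le> 6"
proof -
  have sin: "sin \<theta> > 0" using assms sin_gt_zero by auto
  define t where "t = cos \<theta> / sin \<theta>"
  \<comment> \<open>Center \<open>c s\<close> and squared radius \<open>d s\<close> come from
    completing the square in the equation of \<open>S s\<close>.\<close>
  define c where "c s = (vector [(p $ 1 + r $ 1 - s * t * (r $ 2 - p $ 2)) / 2,
                                 (p $ 2 + r $ 2 + s * t * (r $ 1 - p $ 1)) / 2] :: real ^ 2)" for s
  define d where "d s = (norm (c s))\<^sup>2 - p \<bullet> r + s * t * cross2 p r" for s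
  define S where "S s = {x \<in> P. (p - x) \<bullet> (r - x) = s * t * cross2 (p - x) (r - x)}" for s
  have S: "finite (S s) \<and> card (S s) \<le> 3" for s
  proof (rule general_position_card_sphere[OF assms(1), of _ "c s" "sqrt (d s)"])
    show "S s \<subseteq> P" by (auto simp: S_def)
    show "S s \<subseteq> sphere (c s) (sqrt (d s))"
    proof
      fix x assume "x \<in> S s"
      then have "(norm (c s - x))\<^sup>2 = d s"
        by (simp add: S_def d_def power2_norm_eq_inner inner_2 cross2_def c_def field_simps)
      then show "x \<in> sphere (c s) (sqrt (d s))"
        by (metis mem_sphere dist_norm norm_ge_zero real_sqrt_unique)
    qed
  qed
  have "{x \<in> P. angle_measure p x r = \<theta>} \<subseteq> S 1 \<union> S (-1)"
    using sin_inner_eq_cos_cross2[of p _ r \<theta>] sin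
    by (auto simp: S_def t_def field_simps)
  then have "card {x \<in> P. angle_measure p x r = \<theta>} \<le> card (S 1 \<union> S (-1))"
    using S by (intro card_mono) auto
  also have "\<dots> \<le> card (S 1) + card (S (-1))"
    by (rule card_Un_le)
  also have "\<dots> \<le> 6"
    using S[of 1] S[of "-1"] by simp
  finally show ?thesis .
qed

text \<open>The equality of the two cosines factors into the difference of the legs and a term that
  vanishes only for a degenerate triangle.\<close>

lemma isosceles:
  assumes "angle_measure s q q' = angle_measure s q' q" "angle_measure s q q' \<in> {0<..<pi}"
    "s \<noteq> q" "s \<noteq> q'" "q \<noteq> q'"
  shows "dist s q = dist s q'"
proof -
  define a b where "a = s - q" and "b = s - q'"
  have ab: "a \<noteq> 0" "b \<noteq> 0" "a - b \<noteq> 0" using assms by (auto simp: a_def b_def)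
  have v: "q' - q = a - b" "q - q' = b - a" by (auto simp: a_def b_def)
  have "(a \<bullet> (a - b)) / (norm a * norm (a - b)) = (b \<bullet> (b - a)) / (norm b * norm (a - b))"
    using assms(1) unfolding angle_measure_eq_iff_cos v a_def[symmetric] b_def[symmetric]
    by (simp add: norm_minus_commute)
  then have "(a \<bullet> (a - b)) * norm b = (b \<bullet> (b - a)) * norm a"
    using ab by (simp add: frac_eq_eq) 
  then have "((norm a)\<^sup>2 - a \<bullet> b) * norm b = ((norm b)\<^sup>2 - a \<bullet> b) * norm a"
    by (simp add: inner_diff_right power2_norm_eq_inner inner_commute)
  then have "(norm a - norm b) * (norm a * norm b + a \<bullet> b) = 0"
    by (simp add: algebra_simps power2_eq_square)
  \<comment> \<open>Otherwise \<open>a\<close> and \<open>b\<close> point in opposite directions,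
    \<open>s\<close> lies between \<open>q\<close> and \<open>q'\<close>, and the angle at
    \<open>q\<close> is 0.\<close>
  moreover have "norm a * norm b + a \<bullet> b \<noteq> 0"
  proof
    assume "norm a * norm b + a \<bullet> b = 0"
    then have eq: "a \<bullet> b = - (norm a * norm b)" by simp
    have "(norm (a - b))\<^sup>2 = (norm a + norm b)\<^sup>2"
      using dot_norm_neg[of a b] eq by (simp add: power2_sum)
    then have "norm (a - b) = norm a + norm b"
      by (simp add: power2_eq_iff_nonneg)
    moreover have "a \<bullet> (a - b) = norm a * (norm a + norm b)"
      unfolding inner_diff_right eq dot_square_norm by (simp add: power2_eq_square distrib_left)
    ultimately have "(a \<bullet> (a - b)) / (norm a * norm (a - b)) = 1"
      using ab by (simp add: add_nonneg_eq_0_iff)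
    then show False
      using assms(2) unfolding angle_measure_def v a_def[symmetric] by (simp only:) simp
  qed
  ultimately show ?thesis
    by (simp add: a_def b_def dist_norm)
qed

lemma general_position_card_isosceles:
  assumes "general_position P"
    "\<And>x. x \<in> S \<Longrightarrow> x \<in> P \<and> dist s q = dist s x"
  shows "card S \<le> 3"
  using general_position_card_sphere[OF assms(1), of S s "dist s q"] assms(2)
  by (auto simp: subset_iff)

section \<open>Counting and averaging over choice functions\<close>

text \<open>Split \<open>B\<close> by the values off \<open>j\<close>: there are
  \<open>card P ^ (card I - 1)\<close> classes, each with at most \<open>C\<close> members.\<close>

lemma card_PiE_determined_le:
  assumes "finite I" "j \<in> I" "finite P" "B \<subseteq> I \<rightarrow>\<^sub>E P"
    and "\<And>g. card {x \<in> P. g(j := x) \<in> B} \<le> C"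
  shows "card B \<le> C * card P ^ (card I - 1)"
proof -
  let ?J = "I - {j}"
  have fin: "finite (?J \<rightarrow>\<^sub>E P)" using assms by (intro finite_PiE) auto
  have "B \<subseteq> (\<Union>g \<in> ?J \<rightarrow>\<^sub>E P. (\<lambda>x. g(j := x)) ` {x \<in> P. g(j := x) \<in> B})"
  proof
    fix f assume f: "f \<in> B"
    then have "f \<in> I \<rightarrow>\<^sub>E P" using assms by auto
    \<comment> \<open>Restricting \<open>f\<close> to \<open>?J\<close> means resetting
      \<open>j\<close> to \<open>undefined\<close>, the value of extensional functions outside their
      domain.\<close>
    then have "f(j := undefined) \<in> ?J \<rightarrow>\<^sub>E P" "f j \<in> P" using \<open>j \<in> I\<close>
      by (auto simp: PiE_iff extensional_def)
    moreover have "f = (f(j := undefined))(j := f j)" by simp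
    ultimately show "f \<in> (\<Union>g \<in> ?J \<rightarrow>\<^sub>E P. (\<lambda>x. g(j := x)) ` {x \<in> P. g(j := x) \<in> B})"
      using f by (intro UN_I[of "f(j := undefined)"] image_eqI[of _ _ "f j"]) auto
  qed
  then have "card B \<le> card (\<Union>g \<in> ?J \<rightarrow>\<^sub>E P. (\<lambda>x. g(j := x)) ` {x \<in> P. g(j := x) \<in> B})"
    using fin assms(3) by (intro card_mono finite_UN_I) auto
  also have "\<dots> \<le> (\<Sum>g \<in> ?J \<rightarrow>\<^sub>E P. card ((\<lambda>x. g(j := x)) ` {x \<in> P. g(j := x) \<in> B}))"
    using fin by (rule card_UN_le)
  also have "\<dots> \<le> (\<Sum>g \<in> ?J \<rightarrow>\<^sub>E P. C)"
  proof (intro sum_mono)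
    fix g
    have "card ((\<lambda>x. g(j := x)) ` {x \<in> P. g(j := x) \<in> B}) \<le> card {x \<in> P. g(j := x) \<in> B}"
      using assms(3) by (intro card_image_le) auto
    then show "card ((\<lambda>x. g(j := x)) ` {x \<in> P. g(j := x) \<in> B}) \<le> C"
      using assms(5)[of g] by linarith
  qed
  also have "\<dots> = C * card P ^ (card I - 1)"
    using assms by (simp add: card_PiE)
  finally show ?thesis .
qed

text \<open>First moment method by double counting: each \<open>t\<close> is bad with probability at
  most \<open>C / n\<close>, and some \<open>f\<close> does no worse than the average. Denominators
  are cleared to stay in the naturals.\<close>

lemma exists_few_bad:
  fixes F :: "'f set" and T :: "'t set"
  assumes "finite F" "F \<noteq> {}" "finite T"
    and "\<And>t. t \<in> T \<Longrightarrow> card {f \<in> F. bad f t} * n \<le> C * card F"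
  shows "\<exists>f\<in>F. card {t \<in> T. bad f t} * n \<le> C * card T"
proof (rule ccontr)
  assume "\<not> ?thesis"
  then have "(\<Sum>f\<in>F. C * card T) < (\<Sum>f\<in>F. card {t \<in> T. bad f t} * n)"
    using assms by (intro sum_strict_mono) auto
  also have "\<dots> = (\<Sum>f\<in>F. card {t \<in> T. bad f t}) * n"
    by (simp add: sum_distrib_right)
  also have "(\<Sum>f\<in>F. card {t \<in> T. bad f t}) = (\<Sum>t\<in>T. card {f \<in> F. bad f t})"
    using assms by (intro sum_multicount_gen) auto
  also have "\<dots> * n = (\<Sum>t\<in>T. card {f \<in> F. bad f t} * n)"
    by (simp add: sum_distrib_right)
  also have "\<dots> \<le> (\<Sum>t\<in>T. C * card F)"
    using assms by (intro sum_mono) auto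
  finally show False by (simp add: mult.commute mult.left_commute)
qed

section \<open>Repeated angles as bad tuples of indices\<close>

text \<open>Stated for indices because a random \<open>f\<close> may repeat points. Injectivity is
  asked only on each triple; collisions in general are counted separately.\<close>

definition coincidence ::
    "('i \<Rightarrow> real ^ 2) \<Rightarrow> 'i \<Rightarrow> 'i \<Rightarrow> 'i \<Rightarrow> 'i \<Rightarrow> 'i \<Rightarrow> 'i \<Rightarrow> bool" where
  "coincidence f a b c a' b' c' \<longleftrightarrow>
     distinct [a, b, c] \<and> distinct [a', b', c'] \<and> \<not> (b = b' \<and> {a, c} = {a', c'}) \<and>
     inj_on f {a, b, c} \<and> inj_on f {a', b', c'} \<and>
     angle_measure (f a) (f b) (f c) \<in> {0<..<pi} \<and>
     angle_measure (f a) (f b) (f c) = angle_measure (f a') (f b') (f c')"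

lemma coincidence_swap: "coincidence f c b a a' b' c' = coincidence f a b c a' b' c'"
proof -
  have "{c, b, a} = {a, b, c}" "{c, a} = {a, c}" "distinct [c, b, a] = distinct [a, b, c]"
    by auto
  then show ?thesis
    unfolding coincidence_def angle_measure_commute[of "f c" "f b" "f a"] by simp
qed

lemma coincidence_swap': "coincidence f a b c c' b' a' = coincidence f a b c a' b' c'"
proof -
  have "{c', b', a'} = {a', b', c'}" "{c', a'} = {a', c'}"
    "distinct [c', b', a'] = distinct [a', b', c']"
    by auto
  then show ?thesis
    unfolding coincidence_def angle_measure_commute[of "f c'" "f b'" "f a'"] by simp
qed

text \<open>The second angle does not involve the index \<open>a\<close>, so it fixes
  \<open>\<theta>\<close> while the endpoint \<open>x\<close> varies. The 4 choices are rounded up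
  to 6, the bound for a vertex.\<close>

lemma card_coincidence_endpoint:
  assumes "general_position P" "finite P" "a \<notin> {a', b', c'}"
  shows "card {x \<in> P. coincidence (g(a := x)) a b c a' b' c'} \<le> 6" (is "card ?X \<le> 6")
proof (cases "?X = {}")
  case True
  then show ?thesis by (simp only: card.empty)
next
  case False
  let ?\<theta> = "angle_measure (g a') (g b') (g c')"
  \<comment> \<open>Any member of the set shows that the fixed data, which do not depend on
    \<open>x\<close>, are nondegenerate.\<close>
  from False obtain x where x: "coincidence (g(a := x)) a b c a' b' c'"
    by blast
  then have "g c \<noteq> g b" "?\<theta> \<in> {0<..<pi}"
    using assms(3) by (auto simp: coincidence_def)
  then have "card {x \<in> P. angle_measure x (g b) (g c) = ?\<theta>} \<le> 4"
    by (rule general_position_card_endpoint[OF assms(1)])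
  moreover have "?X \<subseteq> {x \<in> P. angle_measure x (g b) (g c) = ?\<theta>}"
    using assms(3) by (auto simp: coincidence_def)
  then have "card ?X \<le> card {x \<in> P. angle_measure x (g b) (g c) = ?\<theta>}"
    using assms(2) by (intro card_mono) auto
  ultimately show ?thesis by linarith
qed

lemma card_coincidence_center:
  assumes "general_position P" "finite P" "b \<notin> {a', b', c'}"
  shows "card {x \<in> P. coincidence (g(b := x)) a b c a' b' c'} \<le> 6" (is "card ?X \<le> 6")
proof (cases "?X = {}")
  case True
  then show ?thesis by (simp only: card.empty)
next
  case False
  let ?\<theta> = "angle_measure (g a') (g b') (g c')"
  from False obtain x where x: "coincidence (g(b := x)) a b c a' b' c'"
    by blast
  then have "?\<theta> \<in> {0<..<pi}"
    using assms(3) by (auto simp: coincidence_def)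
  then have "card {x \<in> P. angle_measure (g a) x (g c) = ?\<theta>} \<le> 6"
    by (rule general_position_card_center[OF assms(1)])
  moreover have "?X \<subseteq> {x \<in> P. angle_measure (g a) x (g c) = ?\<theta>}"
    using assms(3) by (auto simp: coincidence_def)
  then have "card ?X \<le> card {x \<in> P. angle_measure (g a) x (g c) = ?\<theta>}"
    using assms(2) by (intro card_mono) auto
  ultimately show ?thesis by linarith
qed

text \<open>The equal angles sit at \<open>b\<close> and \<open>c\<close> of one triangle, so the
  point at \<open>c\<close> moves on the circle around \<open>g a\<close> through
  \<open>g b\<close>.\<close>

lemma card_coincidence_isosceles:
  assumes "general_position P"
  shows "card {x \<in> P. coincidence (g(c := x)) a b c a c b} \<le> 6"
proof -
  have "card {x \<in> P. coincidence (g(c := x)) a b c a c b} \<le> 3"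
  proof (rule general_position_card_isosceles[OF assms(1), where s = "g a" and q = "g b"])
    fix x assume x: "x \<in> {x \<in> P. coincidence (g(c := x)) a b c a c b}"
    then have *: "coincidence (g(c := x)) a b c a c b" by simp
    then have ne: "a \<noteq> b" "a \<noteq> c" "b \<noteq> c" and inj: "inj_on (g(c := x)) {a, b, c}"
      unfolding coincidence_def by auto
    have upd: "(g(c := x)) a = g a" "(g(c := x)) b = g b" "(g(c := x)) c = x"
      using ne by auto
    have "angle_measure (g a) (g b) x = angle_measure (g a) x (g b)"
      "angle_measure (g a) (g b) x \<in> {0<..<pi}"
      using * unfolding coincidence_def upd by blast+
    moreover have "g a \<noteq> g b" "g a \<noteq> x" "g b \<noteq> x"
      using inj_onD[OF inj, of a b] inj_onD[OF inj, of a c] inj_onD[OF inj, of b c] ne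
      unfolding upd by blast+
    ultimately have "dist (g a) (g b) = dist (g a) x"
      by (rule isosceles)
    with x show "x \<in> P \<and> dist (g a) (g b) = dist (g a) x" by simp
  qed
  then show ?thesis by simp
qed

lemma card_coincidences:
  assumes P: "general_position P" "finite P" and I: "finite I" "{a, b, c} \<subseteq> I"
  shows "card {f \<in> I \<rightarrow>\<^sub>E P. coincidence f a b c a' b' c'} \<le> 6 * card P ^ (card I - 1)"
    (is "card ?B \<le> _")
proof (cases "distinct [a, b, c] \<and> distinct [a', b', c'] \<and> \<not> (b = b' \<and> {a, c} = {a', c'})")
  case False
  then have "?B = {}" by (auto simp: coincidence_def)
  then show ?thesis by (simp only: card.empty)
next
  case True
  have "\<exists>j\<in>{a, b, c}. \<forall>g. card {x \<in> P. coincidence (g(j := x)) a b c a' b' c'} \<le> 6"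
  proof (cases "{a, b, c} \<subseteq> {a', b', c'}")
    case False
    then consider "a \<notin> {a', b', c'}" | "b \<notin> {a', b', c'}" | "c \<notin> {a', b', c'}" by blast
    then show ?thesis
    proof cases
      case 1
      then show ?thesis
        using card_coincidence_endpoint[OF P 1] by blast
    next
      case 2
      then show ?thesis
        using card_coincidence_center[OF P 2] by blast
    next
      case 3
      then show ?thesis
        using card_coincidence_endpoint[OF P 3, of _ b a]
        unfolding coincidence_swap[of _ a b c] by blast
    qed
  next
    case sub: True
    \<comment> \<open>Both triples now use the same three indices, and equal vertices would give
      equal angles. Two vertices remain for the second angle, with two orders of its endpoints
      each.\<close>
    then consider "a' = a" "b' = c" "c' = b" | "a' = b" "b' = c" "c' = a"
      | "a' = c" "b' = a" "c' = b" | "a' = b" "b' = a" "c' = c"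
      using True by auto
    then show ?thesis
    proof cases
      case 1
      show ?thesis
        unfolding 1 by (intro bexI[of _ c] allI card_coincidence_isosceles[OF P(1)]) simp
    next
      case 2
      show ?thesis
        unfolding 2 coincidence_swap'[of _ a b c b c a]
        by (intro bexI[of _ c] allI card_coincidence_isosceles[OF P(1)]) simp
    next
      case 3
      show ?thesis
        unfolding 3 coincidence_swap[of _ a b c]
        by (intro bexI[of _ a] allI card_coincidence_isosceles[OF P(1)]) simp
    next
      case 4
      show ?thesis
        unfolding 4 coincidence_swap'[of _ c b a b a c] coincidence_swap[of _ a b c]
        by (intro bexI[of _ a] allI card_coincidence_isosceles[OF P(1)]) simp
    qed
  qed
  then obtain j where j: "j \<in> {a, b, c}"
    "\<And>g. card {x \<in> P. coincidence (g(j := x)) a b c a' b' c'} \<le> 6" by blast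
  show ?thesis
  proof (rule card_PiE_determined_le[OF I(1) _ P(2)])
    show "j \<in> I" using j I by blast
    fix g
    have "card {x \<in> P. g(j := x) \<in> ?B} \<le> card {x \<in> P. coincidence (g(j := x)) a b c a' b' c'}"
      using P by (intro card_mono) auto
    then show "card {x \<in> P. g(j := x) \<in> ?B} \<le> 6"
      using j(2) order_trans by blast
  qed auto
qed

text \<open>With the other values fixed, \<open>f a\<close> must be \<open>f b\<close>; for
  \<open>a = b\<close> the set is empty.\<close>

lemma card_collisions:
  assumes "finite P" "finite I" "a \<in> I"
  shows "card {f \<in> I \<rightarrow>\<^sub>E P. a \<noteq> b \<and> f a = f b} \<le> card P ^ (card I - 1)"
proof -
  have "card {f \<in> I \<rightarrow>\<^sub>E P. a \<noteq> b \<and> f a = f b} \<le> 1 * card P ^ (card I - 1)"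
  proof (rule card_PiE_determined_le[OF assms(2,3,1)])
    fix g
    have "{x \<in> P. g(a := x) \<in> {f \<in> I \<rightarrow>\<^sub>E P. a \<noteq> b \<and> f a = f b}} \<subseteq> {g b}" by auto
    then show "card {x \<in> P. g(a := x) \<in> {f \<in> I \<rightarrow>\<^sub>E P. a \<noteq> b \<and> f a = f b}} \<le> 1"
      using card_mono[of "{g b}"] by simp
  qed auto
  then show ?thesis by simp
qed

section \<open>Random choice and deletion\<close>

lemma exists_large_no_repeated_angle:
  assumes P: "general_position P" "finite P" and k: "14 * k ^ 5 \<le> card P" "k > 0"
  shows "\<exists>Q\<subseteq>P. no_repeated_angle Q \<and> k \<le> 2 * card Q"
proof -
  define n where "n = card P"
  define I where "I = {..<k}"
  define F where "F = I \<rightarrow>\<^sub>E P"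
  define T where "T = I \<times> I \<times> I \<times> I \<times> I \<times> I"
  \<comment> \<open>Collisions are tested on the first two entries only, so one family of tuples
    serves both defects.\<close>
  define bad where "bad = (\<lambda>(f :: nat \<Rightarrow> real ^ 2) (a, b, c, a', b', c').
    (a \<noteq> b \<and> f a = f b) \<or> coincidence f a b c a' b' c')"
  have n: "n > 0" using k unfolding n_def by (metis gr0I mult_is_0 power_not_zero le_zero_eq zero_neq_numeral)
  have I: "finite I" "card I = k" by (auto simp: I_def)
  have F: "finite F" "F \<noteq> {}" "card F = n ^ k"
    using P n I by (auto simp: F_def n_def card_PiE PiE_eq_empty_iff intro!: finite_PiE)
  have T: "finite T" "card T = k ^ 6"
    using I by (auto simp: T_def card_cartesian_product eval_nat_numeral)
  \<comment> \<open>The 7 is 1 for a collision plus 6 for a coincidence; the 14 in the hypothesis is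
    twice this, to leave at most \<open>k / 2\<close> bad tuples.\<close>
  have "card {f \<in> F. bad f t} * n \<le> 7 * card F" if "t \<in> T" for t
  proof -
    obtain a b c a' b' c' where t: "t = (a, b, c, a', b', c')"
      by (cases t) auto
    have I': "{a, b, c} \<subseteq> I" "a \<in> I" using that by (auto simp: t T_def)
    have "{f \<in> F. bad f t} = {f \<in> F. a \<noteq> b \<and> f a = f b} \<union> {f \<in> F. coincidence f a b c a' b' c'}"
      by (auto simp: t bad_def)
    then have "card {f \<in> F. bad f t} \<le>
        card {f \<in> F. a \<noteq> b \<and> f a = f b} + card {f \<in> F. coincidence f a b c a' b' c'}"
      by (simp only: card_Un_le)
    also have "\<dots> \<le> n ^ (k - 1) + 6 * n ^ (k - 1)"
      using card_collisions[OF P(2) I(1) I'(2), of b] card_coincidences[OF P I(1) I'(1), of a' b' c']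
      unfolding F_def n_def I(2) by linarith
    finally have "card {f \<in> F. bad f t} * n \<le> 7 * (n ^ (k - 1) * n)"
      by (simp add: mult_right_mono)
    then show ?thesis
      unfolding F(3) power_minus_mult[OF \<open>k > 0\<close>] .
  qed
  from exists_few_bad[of F T bad, OF F(1,2) T(1) this] obtain f where
    f: "f \<in> F" "card {t \<in> T. bad f t} * n \<le> 7 * k ^ 6"
    unfolding T(2) by blast
  define X where "X = {t \<in> T. bad f t}"
  have "card X * (14 * k ^ 5) \<le> card X * n"
    using k unfolding n_def by (intro mult_left_mono) auto
  also have "\<dots> \<le> 7 * k ^ 6"
    using f(2) by (simp only: X_def)
  also have "\<dots> = k * (7 * k ^ 5)"
    using power_Suc[of k 5] by simp
  finally have "(2 * card X) * (7 * k ^ 5) \<le> k * (7 * k ^ 5)"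
    by linarith
  then have X: "2 * card X \<le> k"
    using \<open>k > 0\<close> by simp
  \<comment> \<open>Dropping the first index of every bad tuple destroys them all.\<close>
  define J where "J = I - fst ` X"
  have finX: "finite X" using T by (simp add: X_def)
  have "card (fst ` X) \<le> card X" using finX by (rule card_image_le)
  moreover have "card J \<ge> k - card (fst ` X)"
    unfolding J_def using finX I diff_card_le_card_Diff by (metis finite_imageI)
  ultimately have J: "k \<le> 2 * card J" using X by linarith
  have good: "\<not> bad f (a, b, c, a', b', c')"
    if "a \<in> J" "b \<in> J" "c \<in> J" "a' \<in> J" "b' \<in> J" "c' \<in> J" for a b c a' b' c'
  proof
    assume "bad f (a, b, c, a', b', c')"
    then have "(a, b, c, a', b', c') \<in> X"
      using that by (auto simp: X_def T_def J_def)
    then have "a \<in> fst ` X" by force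
    then show False using that by (simp add: J_def)
  qed
  have inj: "inj_on f J"
  proof (rule inj_onI, rule ccontr)
    fix a b assume "a \<in> J" "b \<in> J" "f a = f b" "a \<noteq> b"
    \<comment> \<open>The collision is padded to a tuple with entries in \<open>J\<close>.\<close>
    then show False using good[of a b a a a a] by (auto simp: bad_def)
  qed
  have "no_repeated_angle (f ` J)"
    unfolding no_repeated_angle_def
  proof (intro allI impI)
    fix p q r p' q' r'
    assume A: "is_angle (f ` J) p q r" "is_angle (f ` J) p' q' r'"
      "angle_measure p q r = angle_measure p' q' r'"
    obtain a b c where abc: "a \<in> J" "b \<in> J" "c \<in> J" "p = f a" "q = f b" "r = f c"
      using A(1) by (auto simp: is_angle_def)
    obtain a' b' c' where abc': "a' \<in> J" "b' \<in> J" "c' \<in> J" "p' = f a'" "q' = f b'" "r' = f c'"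
      using A(2) by (auto simp: is_angle_def)
    have "\<not> coincidence f a b c a' b' c'"
      using good[of a b c a' b' c'] abc abc' by (auto simp: bad_def)
    moreover have "inj_on f {a, b, c}" "inj_on f {a', b', c'}"
      by (rule inj_on_subset[OF inj]; use abc abc' in blast)+
    moreover have "distinct [a, b, c]" "distinct [a', b', c']"
      "angle_measure (f a) (f b) (f c) \<in> {0<..<pi}"
      using A(1,2) abc abc' by (auto simp: is_angle_def)
    ultimately have "b = b' \<and> {a, c} = {a', c'}"
      using A(3) abc abc' unfolding coincidence_def by blast
    then have "b = b'" "f ` {a, c} = f ` {a', c'}" by auto
    then show "q = q' \<and> {p, r} = {p', r'}"
      using abc abc' by simp
  qed
  moreover have "f ` J \<subseteq> P" using f by (auto simp: F_def J_def)
  moreover have "card (f ` J) = card J" using inj by (rule card_image)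
  ultimately show ?thesis using J by metis
qed

lemma card_le_R:
  assumes "finite P" "Q \<subseteq> P" "no_repeated_angle Q"
  shows "card Q \<le> R P"
proof -
  have "{card Q | Q. Q \<subseteq> P \<and> no_repeated_angle Q} \<subseteq> card ` Pow P" by auto
  then have "finite {card Q | Q. Q \<subseteq> P \<and> no_repeated_angle Q}"
    using assms(1) by (meson finite_Pow_iff finite_imageI finite_subset)
  then show ?thesis
    unfolding R_def using assms by (intro Max_ge) auto
qed

section \<open>Points in general position on a parabola\<close>

lemma cross2_eq_0_if_collinear:
  assumes "collinear {x, y, z}"
  shows "cross2 (y - x) (z - x) = 0"
proof -
  obtain u where u: "\<And>v w. v \<in> {x, y, z} \<Longrightarrow> w \<in> {x, y, z} \<Longrightarrow> \<exists>c. v - w = c *\<^sub>R u"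
    using assms unfolding collinear_def by blast
  obtain c d where "y - x = c *\<^sub>R u" "z - x = d *\<^sub>R u"
    using u[of y x] u[of z x] by auto
  then show ?thesis by (simp add: cross2_def)
qed

text \<open>Vieta's formula for the absent cubic coefficient, obtained from divided differences:
  \<open>g\<close> is the first one, \<open>h\<close> the second, and the third is the sum of the
  roots.\<close>

lemma quartic_roots_sum:
  fixes t1 t2 t3 t4 A B C :: real
  assumes "t1 ^ 4 + A * t1\<^sup>2 + B * t1 + C = 0" "t2 ^ 4 + A * t2\<^sup>2 + B * t2 + C = 0"
    "t3 ^ 4 + A * t3\<^sup>2 + B * t3 + C = 0" "t4 ^ 4 + A * t4\<^sup>2 + B * t4 + C = 0"
    and "distinct [t1, t2, t3, t4]"
  shows "t1 + t2 + t3 + t4 = 0"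
proof -
  define g where "g x y = (x + y) * (x\<^sup>2 + y\<^sup>2) + A * (x + y) + B" for x y
  have "(t1 - t2) * g t1 t2 = 0" "(t1 - t3) * g t1 t3 = 0" "(t1 - t4) * g t1 t4 = 0"
    unfolding g_def using assms(1-4) by algebra+
  then have g: "g t1 t2 = 0" "g t1 t3 = 0" "g t1 t4 = 0"
    using assms(5) by auto
  define h where "h x y = t1\<^sup>2 + x\<^sup>2 + y\<^sup>2 + t1 * x + t1 * y + x * y + A" for x y
  have "(t2 - t3) * h t2 t3 = 0" "(t2 - t4) * h t2 t4 = 0"
    using g unfolding g_def h_def by algebra+
  then have "h t2 t3 = 0" "h t2 t4 = 0"
    using assms(5) by auto
  then have "(t3 - t4) * (t1 + t2 + t3 + t4) = 0"
    unfolding h_def by algebra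
  then show ?thesis using assms(5) by auto
qed

text \<open>The abscissas of four common points with a circle are roots of a quartic without cubic
  term, so they sum to 0 and cannot all be positive.\<close>

lemma general_position_parabola:
  fixes S :: "real set"
  assumes "S \<subseteq> {0<..}"
  shows "general_position ((\<lambda>t. vector [t, t\<^sup>2]) ` S)"
proof -
  define p where "p t = (vector [t, t\<^sup>2] :: real ^ 2)" for t
  have "\<not> collinear T" if "T \<subseteq> p ` S" "card T = 3" for T
  proof
    assume "collinear T"
    obtain x y z where "T = {x, y, z}" "x \<noteq> y" "y \<noteq> z" "x \<noteq> z"
      using \<open>card T = 3\<close> by (auto simp: card_3_iff)
    moreover from this have "x \<in> p ` S" "y \<in> p ` S" "z \<in> p ` S"
      using that(1) by auto
    ultimately obtain t1 t2 t3 where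
      t: "T = {p t1, p t2, p t3}" "t1 \<noteq> t2" "t2 \<noteq> t3" "t1 \<noteq> t3"
      by (elim imageE) auto
    then have "cross2 (p t2 - p t1) (p t3 - p t1) = 0"
      using \<open>collinear T\<close> by (intro cross2_eq_0_if_collinear) simp
    \<comment> \<open>The determinant is a Vandermonde determinant.\<close>
    then have "(t2 - t1) * (t3 - t1) * (t3 - t2) = 0"
      by (simp add: cross2_def p_def power2_eq_square algebra_simps)
    then show False using t by auto
  qed
  moreover have "\<not> T \<subseteq> sphere c r" if "T \<subseteq> p ` S" "card T = 4" for T c r
  proof
    assume sphere: "T \<subseteq> sphere c r"
    have "\<exists>w x y z. T = {w, x, y, z} \<and> distinct [w, x, y, z]"
      using \<open>card T = 4\<close> by (auto simp: card_Suc_eq eval_nat_numeral)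
    then obtain w x y z where wxyz: "T = {w, x, y, z}" "distinct [w, x, y, z]" by blast
    moreover have "w \<in> p ` S" "x \<in> p ` S" "y \<in> p ` S" "z \<in> p ` S"
      using that(1) wxyz(1) by auto
    ultimately obtain t1 t2 t3 t4 where t: "T = {p t1, p t2, p t3, p t4}"
      "distinct [t1, t2, t3, t4]" "{t1, t2, t3, t4} \<subseteq> S"
      by (elim imageE) auto
    have *: "s ^ 4 + (1 - 2 * c $ 2) * s\<^sup>2 + (- 2 * c $ 1) * s + (c \<bullet> c - r\<^sup>2) = 0"
      if "p s \<in> T" for s
    proof -
      have "norm (c - p s) = r" using that sphere by (auto simp: dist_norm)
      then have "(c - p s) \<bullet> (c - p s) = r\<^sup>2" by (metis power2_norm_eq_inner)
      then show ?thesis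
        by (simp add: inner_2 p_def power2_eq_square power4_eq_xxxx algebra_simps)
    qed
    have "t1 + t2 + t3 + t4 = 0"
      using t(1,2) by (intro quartic_roots_sum[OF * * * *]) simp_all
    moreover have "t1 > 0" "t2 > 0" "t3 > 0" "t4 > 0"
      using t(3) assms by auto
    ultimately show False by linarith
  qed
  ultimately show ?thesis
    unfolding general_position_def p_def by blast
qed

lemma general_position_exists: "\<exists>P. finite P \<and> card P = n \<and> general_position P"
proof -
  define S where "S = real ` {1..n}"
  define p where "p t = (vector [t, t\<^sup>2] :: real ^ 2)" for t :: real
  have "inj p" by (rule injI) (metis p_def vector_2(1))
  then have "card (p ` S) = n"
    by (simp add: S_def card_image inj_on_def)
  moreover have "general_position (p ` S)"
    unfolding p_def by (rule general_position_parabola) (auto simp: S_def)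
  ultimately show ?thesis
    by (intro exI[of _ "p ` S"]) (simp add: S_def)
qed

section \<open>The lower bound for \<open>R_gen\<close>\<close>

lemma R_gen_ge:
  assumes "14 * k ^ 5 \<le> n" "k > 0"
  shows "k \<le> 2 * R_gen n"
proof -
  \<comment> \<open>An infimum of a nonempty set of naturals is attained.\<close>
  have "R_gen n \<in> {R P | P. finite P \<and> card P = n \<and> general_position P}"
    unfolding R_gen_def using general_position_exists[of n] by (intro Inf_nat_def1) auto
  then obtain P where P: "R_gen n = R P" "finite P" "card P = n" "general_position P" by auto
  then obtain Q where "Q \<subseteq> P" "no_repeated_angle Q" "k \<le> 2 * card Q"
    using exists_large_no_repeated_angle[of P k] assms by auto
  then show ?thesis
    using card_le_R[of P Q] P by simp
qed

theorem theorem6p13: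
  shows "(\<lambda>n::nat. real (R_gen n)) \<in> \<Omega>(\<lambda>n. real n powr (1 / 5))"
proof (rule landau_omega.bigI)
  \<comment> \<open>The 4 is a factor 2 from the deletion times a factor 2 from rounding, as
    \<open>x \<le> k + 1 \<le> 2 * k\<close>.\<close>
  define c :: real where "c = 1 / (4 * 14 powr (1 / 5))"
  show "c > 0" by (simp add: c_def)
  show "\<forall>\<^sub>F n in sequentially. norm (real (R_gen n)) \<ge> c * norm (real n powr (1 / 5))"
    using eventually_ge_at_top[of 14]
  proof eventually_elim
    case (elim n)
    define x where "x = (real n / 14) powr (1 / 5)"
    define k where "k = nat \<lfloor>x\<rfloor>"
    \<comment> \<open>This is where \<open>n \<ge> 14\<close> enters: it makes \<open>k\<close>
      positive.\<close>
    have x: "x \<ge> 1" using elim by (simp add: x_def ge_one_powr_ge_zero)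
    have k: "real k \<le> x" "x \<le> real k + 1" "k \<ge> 1" unfolding k_def using x by linarith+
    have "real k ^ 5 \<le> x ^ 5" using k by (intro power_mono) auto
    also have "x ^ 5 = real n / 14"
      using elim by (simp add: x_def powr_power)
    finally have "real (14 * k ^ 5) \<le> real n" by simp
    then have "14 * k ^ 5 \<le> n" by (simp only: of_nat_le_iff)
    then have "k \<le> 2 * R_gen n" using k by (intro R_gen_ge) auto
    then have "real k \<le> 2 * real (R_gen n)" by linarith
    then have "x / 4 \<le> real (R_gen n)" using k by linarith
    moreover have "x / 4 = c * real n powr (1 / 5)"
      using elim by (simp add: x_def c_def powr_divide)
    ultimately show ?case by simp
  qed
qed

end
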